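(* Let $s,v,m$ be positive integers and $\epsilon\in\{1,-1\}$, excluding the case where $\epsilon=-1$ and $vm^2\le4$. Put $d=svm/2$, $k=s^2v(vm^2+4\epsilon)/4$, $\xi=d+\sqrt{k}$, and $f_\xi(x)=svm-\dfrac{\epsilon s^2v}{x}$ on $\mathbb{R}\cup\{\infty\}$. Let $\delta_\epsilon=0$ if $\epsilon=1$ and $\delta_\epsilon=1$ if $\epsilon=-1$. Let $v_n=v$ for even $n$ and $v_n=1$ for odd $n$, and let $a_0=0$, $a_1=1$, $a_{n+1}=v_nma_n+\epsilon a_{n-1}$. For $n\ge0$ let $s_n=\gcd(a_n,s)$, let $m_n$ be the unique integer with $0\le m_n<s/s_n$ and $m_n\cdot (a_n/s_n)\equiv -a_{n-1}\pmod{s/s_n}$ (for $n=0$ the modulus is $1$ and $m_0=0$), and let $$\hat\xi_n=\frac{s_nv_nm-\epsilon m_n}{s/s_n}.$$ Let $E_0$ be the finite continued fraction expansion of $\hat\xi_0$, and for $n\ge1$ let $E_n$ be the finite continued fraction expansion of $\hat\xi_n-\delta_\epsilon$, where every $E_n$ is chosen to have an odd number of terms if $\epsilon=1$ and an even number of terms if $\epsilon=-1$. Let $[C]=[c_0,c_1,c_2,\dots]$ be the infinite continued fraction whose sequence of terms is the concatenation $E_0,E_1,E_2,\dots$. Then: (a) the continued fraction $[C]$ converges to $\xi$, i.e. its finite truncations $[c_0,\dots,c_j]$ (evaluated in $\mathbb{R}\cup\{\infty\}$) tend to $\xi$ as $j\to\infty$; (b) for every $n\ge0$, the value of the finite continued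 fraction formed by the concatenation $E_0,\dots,E_{n-1}$ equals $f_\xi^n(\infty)$ (for $n=0$ the empty continued fraction is interpreted as $\infty$).
   Context: Finite continued fractions: $[c_0,c_1,\dots,c_n]=c_0+1/(c_1+1/(\cdots+1/c_n))$, evaluated in $\mathbb{R}\cup\{\infty\}$ with $1/0=\infty$, $1/\infty=0$. Every rational number has exactly two finite continued fraction expansions $[c_0,\dots,c_n]$ with $c_0\in\mathbb{Z}$ and $c_1,\dots,c_n$ positive integers; their lengths differ by one, since $[c_0,\dots,c_{n-1},c_n,1]=[c_0,\dots,c_{n-1},c_n+1]$ (for an integer $p$ they are $[p]$ and $[p-1,1]$). "The expansion with an odd/even number of terms" refers to the one of these two with that length parity. The terms of $[C]$ may include zero or negative values at the start of each block $E_n$. The excluded case $\epsilon=-1$, $vm^2\le4$ is exactly where $\xi$ fails to be real and irrational.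
   Formalization: The map is taken as f_ξ(x) = svm + εs²v/x (the one fixing ξ) in place of svm − εs²v/x, since with the minus sign (b) fails at n = 2 for all parameters, e.g. s=v=m=ε=1 gives [1,1]=2 but f_ξ²(∞)=0. *)

theory Defs
  imports "HOL-Analysis.Analysis" "HOL-Number_Theory.Cong" "HOL-Library.Stream"
begin

text \<open>
  The extended line $R \cup \{\infty\}$ is \<^typ>\<open>real option\<close> with \<^term>\<open>None\<close> for $\infty$; its
  topology is \<^term>\<open>Alexandroff_compactification euclideanreal\<close>.
\<close>

fun ext_recip :: "real option \<Rightarrow> real option" where
  "ext_recip None = Some 0"
| "ext_recip (Some x) = (if x = 0 then None else Some (1 / x))"

text \<open>
  \<^const>\<open>map_option\<close> implements $c + \infty = \infty$. With the empty fraction read as $\infty$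
  the recursion gives $[c] = c + 1/\infty = c$.
\<close>

fun cf_value :: "int list \<Rightarrow> real option" where
  "cf_value [] = None"
| "cf_value (c # cs) = map_option (\<lambda>y. real_of_int c + y) (ext_recip (cf_value cs))"

definition is_cf_expansion :: "int list \<Rightarrow> real \<Rightarrow> bool" where
  "is_cf_expansion cs x \<longleftrightarrow> cs \<noteq> [] \<and> (\<forall>c\<in>set (tl cs). 0 < c) \<and> cf_value cs = Some x"

text \<open>The predicate \<open>P\<close> is meant to be \<^term>\<open>even\<close> or \<^term>\<open>odd\<close>.\<close>

definition cf_expansion :: "(nat \<Rightarrow> bool) \<Rightarrow> real \<Rightarrow> int list" where
  "cf_expansion P x = (THE cs. is_cf_expansion cs x \<and> P (length cs))"

definition xi :: "int \<Rightarrow> int \<Rightarrow> int \<Rightarrow> int \<Rightarrow> real" where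
  "xi s v m eps =
     (let d = real_of_int (s * v * m) / 2;
          k = real_of_int (s\<^sup>2 * v * (v * m\<^sup>2 + 4 * eps)) / 4
      in d + sqrt k)"

text \<open>
  The sign in front of \<open>eps\<close>: since $d^2 - k = -\epsilon s^2 v$, the number $\xi$ is a root of
  $x^2 - svm\,x - \epsilon s^2 v$, so the map of the form $2d - (d^2 - k)/x$ that fixes $\xi$ is
  $svm + \epsilon s^2 v / x$.
\<close>

definition f_xi :: "int \<Rightarrow> int \<Rightarrow> int \<Rightarrow> int \<Rightarrow> real option \<Rightarrow> real option" where
  "f_xi s v m eps x =
     map_option (\<lambda>y. real_of_int (s * v * m) + real_of_int (eps * s\<^sup>2 * v) * y) (ext_recip x)"

definition delta :: "int \<Rightarrow> real" where
  "delta eps = (if eps = 1 then 0 else 1)"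

definition v_seq :: "int \<Rightarrow> nat \<Rightarrow> int" where
  "v_seq v n = (if even n then v else 1)"

fun a_seq :: "int \<Rightarrow> int \<Rightarrow> int \<Rightarrow> nat \<Rightarrow> int" where
  "a_seq v m eps 0 = 0"
| "a_seq v m eps (Suc 0) = 1"
| "a_seq v m eps (Suc (Suc n)) =
     v_seq v (Suc n) * m * a_seq v m eps (Suc n) + eps * a_seq v m eps n"

definition s_seq :: "int \<Rightarrow> int \<Rightarrow> int \<Rightarrow> int \<Rightarrow> nat \<Rightarrow> int" where
  "s_seq s v m eps n = gcd (a_seq v m eps n) s"

text \<open>
  For \<open>n = 0\<close> the truncated index \<open>n - 1\<close> is harmless: the modulus is \<open>s div s = 1\<close>.
\<close>

definition m_seq :: "int \<Rightarrow> int \<Rightarrow> int \<Rightarrow> int \<Rightarrow> nat \<Rightarrow> int" where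
  "m_seq s v m eps n =
     (THE k. 0 \<le> k \<and> k < s div s_seq s v m eps n \<and>
        [k * (a_seq v m eps n div s_seq s v m eps n) = - a_seq v m eps (n - 1)]
          (mod (s div s_seq s v m eps n)))"

definition xi_hat :: "int \<Rightarrow> int \<Rightarrow> int \<Rightarrow> int \<Rightarrow> nat \<Rightarrow> real" where
  "xi_hat s v m eps n =
     real_of_int (s_seq s v m eps n * v_seq v n * m - eps * m_seq s v m eps n)
       / real_of_int (s div s_seq s v m eps n)"

definition E_block :: "int \<Rightarrow> int \<Rightarrow> int \<Rightarrow> int \<Rightarrow> nat \<Rightarrow> int list" where
  "E_block s v m eps n =
     cf_expansion (if eps = 1 then odd else even)
       (if n = 0 then xi_hat s v m eps 0 else xi_hat s v m eps n - delta eps)"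

definition C_terms :: "int \<Rightarrow> int \<Rightarrow> int \<Rightarrow> int \<Rightarrow> int stream" where
  "C_terms s v m eps = flat (smap (E_block s v m eps) nats)"


subsection \<open>Well-definedness\<close>

lemma cf_value_pos:
  assumes "cs \<noteq> []" "\<forall>c\<in>set cs. 0 < c"
  shows "\<exists>y. cf_value cs = Some y \<and> 1 \<le> y \<and> (y = 1 \<longrightarrow> cs = [1])"
  using assms
proof (induction cs)
  case Nil
  then show ?case by simp
next
  case (Cons c cs)
  have c: "1 \<le> real_of_int c" using Cons.prems by simp
  show ?case
  proof (cases "cs = []")
    case True
    then show ?thesis using c by auto
  next
    case False
    then obtain y where y: "cf_value cs = Some y" "1 \<le> y"
      using Cons by auto
    have "1 < real_of_int c + 1 / y" using y c by (smt (verit) zero_less_divide_1_iff)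
    moreover have "cf_value (c # cs) = Some (real_of_int c + 1 / y)" using y by simp
    ultimately show ?thesis by auto
  qed
qed

lemma is_cf_expansion_Cons:
  assumes "is_cf_expansion (c # cs) x" "cs \<noteq> []"
  obtains y where "cf_value cs = Some y" "x = of_int c + 1 / y" "1 \<le> y" "y = 1 \<longrightarrow> cs = [1]"
    "is_cf_expansion cs y"
proof -
  obtain y where y: "cf_value cs = Some y" "1 \<le> y" "y = 1 \<longrightarrow> cs = [1]"
    using assms cf_value_pos[of cs] by (auto simp: is_cf_expansion_def)
  have "x = of_int c + 1 / y"
    using assms y by (auto simp: is_cf_expansion_def)
  moreover have "is_cf_expansion cs y"
    using assms y by (auto simp: is_cf_expansion_def dest: list.set_sel(2))
  ultimately show ?thesis using that y by blast
qed

lemma is_cf_expansion_int: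
  assumes "is_cf_expansion (c # cs) (of_int p)"
  shows "c = p \<and> cs = [] \<or> c = p - 1 \<and> cs = [1]"
proof (cases "cs = []")
  case True
  then show ?thesis using assms by (simp add: is_cf_expansion_def)
next
  case False
  then obtain y where y: "real_of_int p = of_int c + 1 / y" "1 \<le> y" "y = 1 \<longrightarrow> cs = [1]"
    using is_cf_expansion_Cons[OF assms] by metis
  have "0 < 1 / y" "1 / y \<le> 1" using y(2) by auto
  then have "real_of_int c < of_int p" "real_of_int p \<le> of_int c + 1" using y(1) by linarith+
  then have "c = p - 1" by linarith
  then show ?thesis using y by auto
qed

lemma is_cf_expansion_unique:
  assumes "is_cf_expansion cs x" "is_cf_expansion ds x" "even (length cs) = even (length ds)"
  shows "cs = ds"
  using assms
proof (induction cs arbitrary: ds x)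
  case Nil
  then show ?case by (simp add: is_cf_expansion_def)
next
  case (Cons c cs)
  obtain d es where ds: "ds = d # es"
    using Cons.prems by (cases ds) (auto simp: is_cf_expansion_def)
  show ?case
  proof (cases "x \<in> \<int>")
    case True
    then obtain p where "x = of_int p" by (auto elim: Ints_cases)
    then show ?thesis
      using is_cf_expansion_int[of c cs p] is_cf_expansion_int[of d es p] Cons.prems ds by auto
  next
    case False
    have ne: "bs \<noteq> []" if "is_cf_expansion (b # bs) x" for b bs
      using that False by (cases bs) (auto simp: is_cf_expansion_def)
    obtain y where y: "x = of_int c + 1 / y" "1 \<le> y" "is_cf_expansion cs y"
      using is_cf_expansion_Cons[OF Cons.prems(1) ne[OF Cons.prems(1)]] by metis
    obtain z where z: "x = of_int d + 1 / z" "1 \<le> z" "is_cf_expansion es z"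
      using is_cf_expansion_Cons[OF Cons.prems(2)[unfolded ds] ne[OF Cons.prems(2)[unfolded ds]]] by metis
    have "y \<noteq> 1" using False y(1) by auto
    moreover have "z \<noteq> 1" using False z(1) by auto
    ultimately have "0 < 1 / y" "1 / y < 1" "0 < 1 / z" "1 / z < 1" using y(2) z(2) by auto
    then have cd: "c = d" using y(1) z(1) by linarith
    then have "1 / y = 1 / z" using y(1) z(1) by simp
    then have "y = z" by simp
    then show ?thesis using Cons.IH[OF y(3), of es] z(3) Cons.prems(3) ds cd by auto
  qed
qed

lemma is_cf_expansion_exists:
  fixes p q :: int
  assumes "0 < q"
  shows "\<exists>cs. is_cf_expansion cs (of_int p / of_int q) \<and> even (length cs) = b"
  using assms
proof (induction "nat q" arbitrary: p q b rule: less_induct)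
  case less
  define r where "r = p mod q"
  have r: "0 \<le> r" "r < q" using less.prems by (auto simp: r_def)
  have "p = q * (p div q) + r" by (simp add: r_def)
  then have "real_of_int p = of_int q * of_int (p div q) + of_int r"
    by (metis of_int_add of_int_mult)
  then have pq: "real_of_int p / of_int q = of_int (p div q) + of_int r / of_int q"
    using less.prems by (simp add: field_simps)
  show ?case
  proof (cases "r = 0")
    case True
    have "is_cf_expansion [p div q] (of_int p / of_int q)"
      "is_cf_expansion [p div q - 1, 1] (of_int p / of_int q)"
      using True pq by (auto simp: is_cf_expansion_def)
    then show ?thesis
      by (cases b) (rule exI[of _ "[p div q - 1, 1]"], simp, rule exI[of _ "[p div q]"], simp)
  next
    case False
    then obtain cs where cs: "is_cf_expansion cs (of_int q / of_int r)" "even (length cs) = (\<not> b)"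
      using less.hyps[of r q "\<not> b"] r by auto
    obtain c cs' where cs': "cs = c # cs'"
      using cs by (cases cs) (auto simp: is_cf_expansion_def)
    have gt: "1 < real_of_int q / of_int r" using r False by simp
    have "0 < c"
    proof (cases "cs' = []")
      case True
      then show ?thesis using cs(1) cs' gt by (simp add: is_cf_expansion_def)
    next
      case False
      then obtain y where "real_of_int q / of_int r = of_int c + 1 / y" "1 \<le> y"
        using is_cf_expansion_Cons[OF cs(1)[unfolded cs']] by metis
      moreover have "1 / y \<le> 1" using \<open>1 \<le> y\<close> by simp
      ultimately have "0 < real_of_int c" using gt by linarith
      then show ?thesis by simp
    qed
    then have "is_cf_expansion (p div q # cs) (of_int p / of_int q)"
      using cs cs' pq r False by (auto simp: is_cf_expansion_def)
    then show ?thesis using cs(2) by (intro exI[of _ "p div q # cs"]) auto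
  qed
qed

lemma cf_expansion_ex1:
  assumes "x \<in> \<rat>" "P = even \<or> P = odd"
  shows "\<exists>!cs. is_cf_expansion cs x \<and> P (length cs)"
proof -
  obtain p q :: int where pq: "0 < q" "x = of_int p / of_int q"
    using assms(1) by (metis Rats_cases')
  obtain b where b: "\<And>n. P n = (even n = b)" using assms(2) by fastforce
  obtain cs where "is_cf_expansion cs x" "P (length cs)"
    using is_cf_expansion_exists[OF pq(1), of p b] pq(2) b by auto
  moreover have "ds = cs" if "is_cf_expansion ds x" "P (length ds)" for ds
    using is_cf_expansion_unique[OF that(1) \<open>is_cf_expansion cs x\<close>] that(2)
      \<open>P (length cs)\<close> b by auto
  ultimately show ?thesis by blast
qed

lemma m_seq_ex1:
  assumes "0 < s"
  shows "\<exists>!k. 0 \<le> k \<and> k < s div s_seq s v m eps n \<and>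
           [k * (a_seq v m eps n div s_seq s v m eps n) = - a_seq v m eps (n - 1)]
             (mod (s div s_seq s v m eps n))"
proof -
  define A where "A = a_seq v m eps n div s_seq s v m eps n"
  define M where "M = s div s_seq s v m eps n"
  define B where "B = - a_seq v m eps (n - 1)"
  have cop: "coprime A M"
    unfolding A_def M_def s_seq_def using assms by (intro div_gcd_coprime) auto
  have M: "0 < M"
    unfolding M_def s_seq_def using assms
    by (simp add: pos_imp_zdiv_pos_iff zdvd_imp_le)
  obtain i where i: "[A * i = 1] (mod M)"
    using cong_solve_coprime_int[OF cop] by blast
  define k where "k = (B * i) mod M"
  have "[k * A = B * i * A] (mod M)"
    unfolding k_def by (simp add: cong_def mod_mult_left_eq)
  also have "[B * i * A = B * 1] (mod M)"
    using cong_scalar_left[OF i, of B] by (simp add: ac_simps)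
  finally have "[k * A = B] (mod M)" by simp
  moreover have "0 \<le> k" "k < M" using M by (auto simp: k_def)
  moreover have "l = k" if "0 \<le> l" "l < M" "[l * A = B] (mod M)" for l
  proof -
    have "[l * A = k * A] (mod M)"
      using that(3) \<open>[k * A = B] (mod M)\<close> by (metis cong_sym cong_trans)
    then have "[l = k] (mod M)" using cop cong_mult_rcancel by blast
    then show ?thesis using that \<open>0 \<le> k\<close> \<open>k < M\<close> by (simp add: cong_def)
  qed
  ultimately show ?thesis unfolding A_def M_def B_def by blast
qed

lemma f_xi_fixed_point:
  assumes "0 < s" "0 < v" "0 < m" "eps = 1 \<or> eps = -1 \<and> 4 < v * m\<^sup>2"
  shows "f_xi s v m eps (Some (xi s v m eps)) = Some (xi s v m eps)"
proof -
  define d where "d = real_of_int (s * v * m) / 2"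
  define k where "k = real_of_int (s\<^sup>2 * v * (v * m\<^sup>2 + 4 * eps)) / 4"
  have "0 \<le> s\<^sup>2 * v * (v * m\<^sup>2 + 4 * eps)" using assms by auto
  then have "0 \<le> k" unfolding k_def by (metis of_int_0_le_iff zero_le_divide_iff zero_le_numeral)
  have "0 < d" using assms by (simp add: d_def)
  have xi: "xi s v m eps = d + sqrt k" by (simp add: xi_def d_def k_def)
  have pos: "0 < d + sqrt k" using \<open>0 < d\<close> \<open>0 \<le> k\<close> by (simp add: add_pos_nonneg)
  have kd: "k = d\<^sup>2 + of_int (eps * s\<^sup>2 * v)"
    by (simp add: k_def d_def power2_eq_square field_simps)
  have "(d + sqrt k)\<^sup>2 = d\<^sup>2 + 2 * d * sqrt k + k"
    using \<open>0 \<le> k\<close> by (simp add: power2_sum)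
  also have "\<dots> = 2 * d * (d + sqrt k) + of_int (eps * s\<^sup>2 * v)"
    by (subst (2) kd) (simp add: power2_eq_square algebra_simps)
  finally have "2 * d + of_int (eps * s\<^sup>2 * v) * (1 / (d + sqrt k)) = d + sqrt k"
    using pos by (simp add: field_simps power2_eq_square)
  then show ?thesis using pos unfolding f_xi_def xi by (simp add: d_def)
qed

end

theory Submission
  imports Defs
begin

text \<open>
  Write a finite continued fraction as a product of the integer matrices with rows \<open>(c, 1)\<close> and
  \<open>(1, 0)\<close>. Up to scalars $f_\xi^n = A \, g_0 \cdots g_{n-1} A'$, where $A(x) = s x$,
  $g_i(x) = v_i m + \epsilon / x$, and $A'$ is a dilation. Put
  $T_n(x) = (s x / s_n + \epsilon m_n) / s_n$, with $x$ replaced by $x + 1$ if $\epsilon = -1$ and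
  $n \ge 1$. Then $T_n^{-1} g_n T_{n+1}$ is an integral matrix with lower row
  \<open>(q, q')\<close>, $q = s / (s_n s_{n+1})$, determinant $-\epsilon$, and it maps $\infty$ to
  $\hat\xi_n$ or $\hat\xi_n - 1$. The bounds on $m_{n+1}$ put $q'$ into the range
  that forces this matrix to be the matrix of $E_n$, so the products telescope.

  For the convergence, a truncation inside $E_n$ differs from $f_\xi^n(\infty)$ by at most
  $s^2 / a_n$, and $f_\xi^n(\infty) - \xi$ is $O(1 / a_n)$.
\<close>

section \<open>Matrices of finite continued fractions\<close>

text \<open>Action of the product of the matrices of the terms on a column vector. The pair
  \<open>cf_num\<close>, \<open>cf_den\<close> is the first column of that product. For nonempty
  \<open>cs\<close> the second column, \<open>cf_num'\<close> and \<open>cf_den'\<close>, belongs to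
  the fraction without its last term.\<close>

fun cf_act :: "int list \<Rightarrow> int \<times> int \<Rightarrow> int \<times> int" where
  "cf_act [] w = w"
| "cf_act (c # cs) w = (c * fst (cf_act cs w) + snd (cf_act cs w), fst (cf_act cs w))"

abbreviation cf_num :: "int list \<Rightarrow> int" where "cf_num cs \<equiv> fst (cf_act cs (1, 0))"
abbreviation cf_den :: "int list \<Rightarrow> int" where "cf_den cs \<equiv> snd (cf_act cs (1, 0))"
abbreviation cf_num' :: "int list \<Rightarrow> int" where "cf_num' cs \<equiv> fst (cf_act cs (0, 1))"
abbreviation cf_den' :: "int list \<Rightarrow> int" where "cf_den' cs \<equiv> snd (cf_act cs (0, 1))"

lemma cf_act_append: "cf_act (cs @ ds) w = cf_act cs (cf_act ds w)"
  by (induction cs) auto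

lemma cf_act_snoc: "cf_act (cs @ [c]) w = cf_act cs (c * fst w + snd w, fst w)"
  by (simp add: cf_act_append)

lemma cf_act_linear:
  "cf_act cs w = (fst w * cf_num cs + snd w * cf_num' cs, fst w * cf_den cs + snd w * cf_den' cs)"
  by (induction cs) (auto simp: algebra_simps)

lemma cf_act_det: "cf_num cs * cf_den' cs - cf_num' cs * cf_den cs = (-1) ^ length cs"
  by (induction cs) (auto simp: algebra_simps)

text \<open>Homogeneous coordinates on the extended line; the pair \<open>(0, 0)\<close>, which is
  no point, also gives \<open>None\<close>.\<close>

definition proj_ratio :: "int \<Rightarrow> int \<Rightarrow> real option" where
  "proj_ratio x y = (if y = 0 then None else Some (of_int x / of_int y))"

lemma proj_ratio_scale: "k \<noteq> 0 \<Longrightarrow> proj_ratio (k * x) (k * y) = proj_ratio x y"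
  by (simp add: proj_ratio_def)

lemma cf_value_eq_proj_ratio: "cf_value cs = proj_ratio (cf_num cs) (cf_den cs)"
proof (induction cs)
  case Nil
  then show ?case by (simp add: proj_ratio_def)
next
  case (Cons c cs)
  \<comment> \<open>Away from \<open>(0, 0)\<close>, \<open>ext_recip\<close> just swaps the
    coordinates. The determinant, which is 1 or -1, excludes that pair.\<close>
  have "\<not> (cf_num cs = 0 \<and> cf_den cs = 0)"
    using cf_act_det[of cs] by auto
  then show ?case
    by (auto simp: Cons.IH proj_ratio_def add_divide_distrib)
qed

text \<open>Appending \<open>c\<close> turns the denominators \<open>(q, q')\<close> into
  \<open>(c * q + q', q)\<close>, hence the induction from the right. The first term
  \<open>b\<close> may have any sign because the denominators do not depend on it. The two boundary
  cases occur only for one term and for two terms, that is, for opposite parities.\<close>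

lemma cf_den_bounds:
  assumes "\<forall>c\<in>set cs. 0 < c"
  shows "1 \<le> cf_den (b # cs) \<and> 0 \<le> cf_den' (b # cs) \<and> cf_den' (b # cs) \<le> cf_den (b # cs) \<and>
    (cf_den' (b # cs) = 0 \<longrightarrow> cs = []) \<and> (cf_den' (b # cs) = cf_den (b # cs) \<longrightarrow> length cs = 1)"
  using assms
proof (induction cs rule: rev_induct)
  case Nil
  then show ?case by simp
next
  case (snoc c cs)
  define q q' where "q = cf_den (b # cs)" and "q' = cf_den' (b # cs)"
  have IH: "1 \<le> q" "0 \<le> q'" "q' = 0 \<longrightarrow> cs = []"
    using snoc unfolding q_def q'_def by auto
  have c: "1 \<le> c" using snoc.prems by auto
  have eq: "cf_den (b # cs @ [c]) = c * q + q'" "cf_den' (b # cs @ [c]) = q"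
    using cf_act_snoc[of "b # cs" c] cf_act_linear[of "b # cs" "(c, 1)"]
    unfolding q_def q'_def by simp_all
  define k where "k = c * q"
  have "q \<le> k" using c IH unfolding k_def by simp
  then show ?case unfolding eq k_def[symmetric] using IH by auto
qed

lemma cf_den_prefix_le:
  assumes "\<forall>c\<in>set (cs @ ds). 0 < c"
  shows "cf_den (b # cs) \<le> cf_den (b # cs @ ds)"
  using assms
proof (induction ds rule: rev_induct)
  case Nil
  then show ?case by simp
next
  case (snoc c ds)
  define q q' where "q = cf_den (b # cs @ ds)" and "q' = cf_den' (b # cs @ ds)"
  have q: "1 \<le> q" "0 \<le> q'"
    using cf_den_bounds[of "cs @ ds" b] snoc.prems unfolding q_def q'_def by auto
  have c: "1 \<le> c" using snoc.prems by auto
  have eq: "cf_den (b # cs @ ds @ [c]) = c * q + q'"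
    using cf_act_snoc[of "b # cs @ ds" c] cf_act_linear[of "b # cs @ ds" "(c, 1)"]
    unfolding q_def q'_def by simp
  have "cf_den (b # cs) \<le> q" using snoc unfolding q_def by simp
  also have "q \<le> c * q" using c q by simp
  also have "\<dots> \<le> c * q + q'" using q by simp
  finally show ?case unfolding eq[symmetric] by simp
qed

text \<open>
  An expansion of given parity is recognised by a matrix: the determinant fixes the second column
  modulo the first one, and the range of \<open>q'\<close> fixes the representative.
\<close>

lemma cf_act_expansion_eqI:
  assumes cs: "is_cf_expansion cs (of_int p / of_int q)" and q: "0 < q"
    and det: "p * q' - p' * q = (-1) ^ length cs"
    and odd: "odd (length cs) \<Longrightarrow> 0 \<le> q' \<and> q' < q"
    and even: "even (length cs) \<Longrightarrow> 0 < q' \<and> q' \<le> q"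
  shows "cf_act cs (1, 0) = (p, q)" and "cf_act cs (0, 1) = (p', q')"
proof -
  obtain b bs where bs: "cs = b # bs" "\<forall>c\<in>set bs. 0 < c"
    using cs by (cases cs) (auto simp: is_cf_expansion_def)
  define P Q P' Q' where defs: "P = cf_num cs" "Q = cf_den cs" "P' = cf_num' cs" "Q' = cf_den' cs"
  have Q: "1 \<le> Q" "0 \<le> Q'" "Q' \<le> Q" "Q' = 0 \<longrightarrow> length cs = 1" "Q' = Q \<longrightarrow> length cs = 2"
    using cf_den_bounds[OF bs(2), of b] unfolding defs bs(1) by auto
  have det': "P * Q' - P' * Q = (-1) ^ length cs"
    unfolding defs by (rule cf_act_det)
  have "Some (of_int P / of_int Q) = Some (of_int p / of_int q :: real)"
    using cs Q unfolding is_cf_expansion_def cf_value_eq_proj_ratio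
    by (auto simp: proj_ratio_def defs split: if_splits)
  then have "real_of_int P * of_int q = of_int p * of_int Q"
    using q Q by (simp add: field_simps)
  then have PQ: "P * q = p * Q"
    by (metis of_int_eq_iff of_int_mult)
  have unit: "(-1 :: int) ^ length cs * (-1) ^ length cs = 1"
    by (simp flip: power_add)
  have "coprime p q"
  proof (rule coprimeI)
    fix d assume "d dvd p" "d dvd q"
    then have "d dvd (-1) ^ length cs" unfolding det[symmetric] by simp
    then show "is_unit d" by (metis dvd_trans dvd_triv_left unit)
  qed
  moreover have "coprime P Q"
  proof (rule coprimeI)
    fix d assume "d dvd P" "d dvd Q"
    then have "d dvd (-1) ^ length cs" unfolding det'[symmetric] by simp
    then show "is_unit d" by (metis dvd_trans dvd_triv_left unit)
  qed
  ultimately have "q dvd Q" "Q dvd q"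
    using PQ by (metis coprime_commute coprime_dvd_mult_right_iff dvd_triv_right,
        metis coprime_commute coprime_dvd_mult_right_iff dvd_triv_right)
  then have qQ: "q = Q" using q Q(1) by (intro zdvd_antisym_nonneg) auto
  then have pP: "p = P" using PQ q by simp
  have eq: "P * (q' - Q') = (p' - P') * Q"
    using det det' unfolding qQ pP by (simp add: algebra_simps)
  then have "Q dvd q' - Q'"
    using \<open>coprime P Q\<close> by (metis coprime_commute coprime_dvd_mult_right_iff dvd_triv_right)
  \<comment> \<open>For odd length \<open>q'\<close> and \<open>Q'\<close> both lie in the range
    from 0 to \<open>Q - 1\<close>, for even length in the range from 1 to \<open>Q\<close>. Either
    range contains one representative of each class modulo \<open>Q\<close>.\<close>
  moreover have "\<bar>q' - Q'\<bar> < Q"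
  proof (cases "even (length cs)")
    case True
    then have "Q' \<noteq> 0" using Q(4) by auto
    then show ?thesis using even[OF True] Q qQ by auto
  next
    case False
    then have "Q' \<noteq> Q" using Q(5) by auto
    then show ?thesis using odd[OF False] Q qQ by auto
  qed
  ultimately have "q' = Q'"
    by (metis dvd_abs_iff eq_iff_diff_eq_0 zdvd_not_zless zero_less_abs_iff)
  moreover from this have "p' = P'" using eq Q by auto
  ultimately show "cf_act cs (1, 0) = (p, q)" "cf_act cs (0, 1) = (p', q')"
    using qQ pP by (auto simp: defs prod_eq_iff)
qed

section \<open>The matrix of a block\<close>

lemma div_int_eqI: "x = k * d \<Longrightarrow> d \<noteq> 0 \<Longrightarrow> x div d = k" for x k d :: int
  by simp

text \<open>With \<open>b = a div gcd a s\<close> and \<open>b1 = a1 div gcd a1 s\<close>, the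
  hypotheses become \<open>b * p = b1\<close> and \<open>t * b1 = - b\<close> modulo
  \<open>q\<close>. Eliminating \<open>b1\<close> and cancelling the unit \<open>b\<close> leaves
  \<open>p * t = -1\<close>. The fraction \<open>p / q\<close> will be \<open>xi_hat\<close>, and
  the last congruence makes the second column of the block matrix integral.\<close>

lemma block_matrix_congruences:
  fixes s a a1 a' w eps m0 m1 :: int
  assumes s: "0 < s" and cop: "coprime a a1" and rec: "a1 = w * a + eps * a'"
    and m0: "[m0 * (a div gcd a s) = - a'] (mod (s div gcd a s))"
    and m1: "[m1 * (a1 div gcd a1 s) = - a] (mod (s div gcd a1 s))"
  obtains q p t where "0 < q" "q * gcd a s * gcd a1 s = s"
    "p * gcd a1 s = gcd a s * w - eps * m0" "t * gcd a s = m1" "[p * t = -1] (mod q)"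
proof -
  define s0 s1 where "s0 = gcd a s" and "s1 = gcd a1 s"
  have pos: "0 < s0" "0 < s1" using s by (auto simp: s0_def s1_def)
  obtain b where b: "a = s0 * b" unfolding s0_def by (metis dvdE gcd_dvd1)
  obtain b1 where b1: "a1 = s1 * b1" unfolding s1_def by (metis dvdE gcd_dvd1)
  have "coprime s0 s1" using cop b b1 by simp
  then have "s0 * s1 dvd s" by (simp add: divides_mult s0_def s1_def)
  then obtain q where q: "s = q * s0 * s1" by (metis dvdE mult.assoc mult.commute)
  have "0 < q" using s pos unfolding q by (simp add: zero_less_mult_iff)
  have sdiv: "s div s0 = q * s1" "s div s1 = q * s0" "a div s0 = b" "a1 div s1 = b1"
    using pos q b b1 by auto
  have cop_b: "coprime b (q * s1)"
    using div_gcd_coprime[of a s] s sdiv unfolding s0_def[symmetric] by auto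
  have cop_b1: "coprime b1 s0" using cop b b1 by (simp add: coprime_commute)
  have M0: "q * s1 dvd m0 * b + a'"
    using m0 unfolding s0_def[symmetric] sdiv by (simp add: cong_iff_dvd_diff)
  have M1: "q * s0 dvd m1 * b1 + a"
    using m1 unfolding s1_def[symmetric] sdiv by (simp add: cong_iff_dvd_diff)
  have "s0 dvd m1 * b1 + s0 * b" using M1 b by (metis dvd_mult_right)
  then have "s0 dvd m1 * b1" by (simp add: dvd_add_left_iff)
  then have "s0 dvd m1" using cop_b1 by (metis coprime_commute coprime_dvd_mult_left_iff)
  then obtain t where t: "m1 = t * s0" by (metis dvdE mult.commute)
  \<comment> \<open>The recurrence eliminates \<open>a'\<close>, so the congruence for
    \<open>m0\<close> becomes one for the numerator of \<open>xi_hat\<close>.\<close>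
  have "b * (s0 * w - eps * m0) = a1 - eps * (m0 * b + a')"
    unfolding rec b by (simp add: algebra_simps)
  then have D: "q * s1 dvd b * (s0 * w - eps * m0) - a1" using M0 by simp
  then have "s1 dvd b * (s0 * w - eps * m0) - s1 * b1" using b1 by (metis dvd_mult_right)
  then have "s1 dvd b * (s0 * w - eps * m0)" by (simp add: dvd_diff_left_iff)
  moreover have "coprime s1 b" using cop_b by (simp add: coprime_commute)
  ultimately have "s1 dvd s0 * w - eps * m0" by (metis coprime_dvd_mult_right_iff)
  then obtain p where p: "s0 * w - eps * m0 = p * s1" by (metis dvdE mult.commute)
  have "q * s1 dvd (b * p - b1) * s1"
    using D unfolding p b1 by (simp add: algebra_simps)
  then have D1: "q dvd b * p - b1" using pos by simp
  have "q * s0 dvd (t * b1 + b) * s0"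
    using M1 unfolding t b by (simp add: algebra_simps)
  then have D2: "q dvd t * b1 + b" using pos by simp
  have "b * (p * t + 1) = t * (b * p - b1) + (t * b1 + b)" by (simp add: algebra_simps)
  then have "q dvd b * (p * t + 1)" using D1 D2 by simp
  moreover have "coprime q b" using cop_b by (simp add: coprime_commute)
  ultimately have "q dvd p * t + 1" by (metis coprime_dvd_mult_right_iff)
  then have "[p * t = -1] (mod q)" by (simp add: cong_iff_dvd_diff)
  then show ?thesis
    using that[of q p t] \<open>0 < q\<close> q p t unfolding s0_def[symmetric] s1_def[symmetric] by simp
qed

text \<open>A truncation consists of complete blocks and a nonempty initial piece \<open>us\<close>
  of the next one, possibly all of it. The bound on \<open>j\<close> forces \<open>n\<close> to grow
  with \<open>j\<close>.\<close>

lemma stake_flat_blocks: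
  assumes ne: "\<And>n. E n \<noteq> []"
  obtains n us ws where "stake (Suc j) (flat (smap E nats)) = concat (map E [0..<n]) @ us"
    "us \<noteq> []" "E n = us @ ws" "j < length (concat (map E [0..<Suc n]))"
proof -
  define B where "B n = concat (map E [0..<n])" for n
  have flat: "flat (smap E (fromN n)) = E n @- flat (smap E (fromN (Suc n)))" for n
    using flat_unfold[of "smap E (fromN n)"] ne by simp
  have split: "flat (smap E nats) = B n @- flat (smap E (fromN n))" for n
  proof (induction n)
    case 0
    then show ?case by (simp add: B_def)
  next
    case (Suc n)
    then show ?case by (subst (asm) flat) (simp add: B_def)
  qed
  have len: "n \<le> length (B n)" for n
  proof (induction n)
    case (Suc n)
    moreover have "0 < length (E n)" using ne[of n] by simp
    ultimately have "Suc n \<le> length (B n) + length (E n)" by linarith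
    then show ?case by (simp add: B_def)
  qed simp
  \<comment> \<open>The block containing the term with index \<open>j\<close>, which is the last one
    of the truncation.\<close>
  define n where "n = (LEAST n. j < length (B (Suc n)))"
  have n: "j < length (B (Suc n))"
    unfolding n_def by (rule LeastI[of _ j]) (use len[of "Suc j"] in simp)
  have n': "length (B n) \<le> j"
  proof (cases n)
    case 0
    then show ?thesis by (simp add: B_def)
  next
    case (Suc k)
    then have "\<not> j < length (B (Suc k))" unfolding n_def by (metis lessI not_less_Least)
    then show ?thesis using Suc by simp
  qed
  define i where "i = Suc j - length (B n)"
  have i: "0 < i" "i \<le> length (E n)" using n n' by (auto simp: i_def B_def)
  have "stake (Suc j) (flat (smap E nats)) = B n @ stake i (flat (smap E (fromN n)))"
    using n' by (subst split[of n]) (simp add: stake_shift i_def)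
  also have "stake i (flat (smap E (fromN n))) = take i (E n)"
    using i by (subst flat) (simp add: stake_shift)
  finally show ?thesis
    using that[of n "take i (E n)" "drop i (E n)"] i n ne[of n] by (simp add: B_def)
qed

text \<open>Inductive step for \<open>B_matrix\<close>, as pure algebra. The equations for
  \<open>P\<close>, \<open>Q\<close>, \<open>P'\<close>, \<open>Q'\<close> say, cleared of
  denominators, that the matrix of the first \<open>n\<close> blocks is that of
  \<open>A g_0 ... g_{n-1} T_n\<close> divided by \<open>s\<close>. The conclusions say the same for
  \<open>n + 1\<close>. The numbers \<open>h\<close> and \<open>h1\<close> are the shifts at
  \<open>n\<close> and \<open>n + 1\<close>.\<close>

lemma block_step:
  fixes s eps m :: int
  assumes nz: "g0 \<noteq> 0" "g1 \<noteq> 0" "q \<noteq> 0" "s \<noteq> 0"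
    and s: "q * g0 * g1 = s" and det: "p * q' - p' * q = - eps"
    and p: "p * g1 = g0 * u0 * m - eps * r0 - h * q * g1"
    and q': "q' * g0 = eps * r1 + h1 * q * g0"
    and P: "g0 * P = s * u1 * a1" and Q: "g0 * Q = a0"
    and P': "P' = eps * (r0 * u1 * a1 + g0 * u0 * a0) + h * P"
    and Q': "s * Q' = eps * (r0 * a0 + g0 * b) + h * s * Q"
    and new: "R = p * P + q * P'" "T = p * Q + q * Q'"
      "R' = p' * P + q' * P'" "T' = p' * Q + q' * Q'"
    and u2: "u2 = u0" and a1: "a1 = u0 * m * a0 + eps * b" and a2: "a2 = u1 * m * a1 + eps * a0"
  shows "g1 * R = s * u2 * a2" "g1 * T = a1"
    "R' = eps * (r1 * u2 * a2 + g1 * u1 * a1) + h1 * R"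
    "s * T' = eps * (r1 * a1 + g1 * a0) + h1 * s * T"
proof -
  show R: "g1 * R = s * u2 * a2"
  proof -
    have "g0 * (g1 * R) = (g0 * P) * (p * g1) + (q * g0 * g1) * P'"
      unfolding new by (simp add: algebra_simps)
    also have "\<dots> = (g0 * P) * (g0 * u0 * m - eps * r0) + s * (P' - h * P)"
      unfolding p s[symmetric] by (simp add: algebra_simps)
    also have "\<dots> = s * u1 * a1 * (g0 * u0 * m - eps * r0)
        + s * (eps * (r0 * u1 * a1 + g0 * u0 * a0))"
      unfolding P by (simp add: P')
    also have "\<dots> = g0 * (s * u0 * (u1 * m * a1 + eps * a0))"
      by (simp add: algebra_simps)
    finally show ?thesis using nz by (simp add: u2 a2)
  qed
  show T: "g1 * T = a1"
  proof -
    have "s * (g0 * (g1 * T)) = s * (g0 * Q) * (p * g1) + (q * g0 * g1) * (s * Q')"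
      unfolding new by (simp add: algebra_simps)
    also have "\<dots> = s * (g0 * Q) * (g0 * u0 * m - eps * r0) + s * (s * Q' - h * s * Q)"
      unfolding p by (simp add: s[symmetric] algebra_simps)
    also have "\<dots> = s * a0 * (g0 * u0 * m - eps * r0) + s * (eps * (r0 * a0 + g0 * b))"
      unfolding Q by (simp add: Q')
    also have "\<dots> = s * (g0 * a1)"
      unfolding a1 by (simp add: algebra_simps)
    finally show ?thesis using nz by simp
  qed
  \<comment> \<open>The entry \<open>p'\<close> is known only through the determinant, so the second
    column is computed after multiplication by \<open>q\<close>.\<close>
  have pq: "p' * q = p * q' + eps" using det by simp
  show R': "R' = eps * (r1 * u2 * a2 + g1 * u1 * a1) + h1 * R"
  proof -
    have "q * R' = (p' * q) * P + q * q' * P'" unfolding new by (simp add: algebra_simps)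
    also have "\<dots> = q' * R + eps * P" unfolding pq new by (simp add: algebra_simps)
    finally have qR: "q * R' = q' * R + eps * P" .
    have "s * R' = g0 * g1 * (q * R')" by (subst s[symmetric]) (simp add: algebra_simps)
    also have "\<dots> = (q' * g0) * (g1 * R) + eps * g1 * (g0 * P)"
      unfolding qR by (simp add: algebra_simps)
    also have "\<dots> = eps * r1 * (g1 * R) + eps * g1 * (g0 * P)
        + h1 * (q * g0 * g1) * R"
      unfolding q' by (simp add: algebra_simps)
    also have "\<dots> = s * (eps * (r1 * u2 * a2 + g1 * u1 * a1) + h1 * R)"
      unfolding R P s by (simp only: algebra_simps)
    finally show ?thesis using nz by (metis mult_cancel_left)
  qed
  show T': "s * T' = eps * (r1 * a1 + g1 * a0) + h1 * s * T"
  proof -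
    have "q * T' = (p' * q) * Q + q * q' * Q'" unfolding new by (simp add: algebra_simps)
    also have "\<dots> = q' * T + eps * Q" unfolding pq new by (simp add: algebra_simps)
    finally have qT: "q * T' = q' * T + eps * Q" .
    have "s * T' = g0 * g1 * (q * T')" by (subst s[symmetric]) (simp add: algebra_simps)
    also have "\<dots> = (q' * g0) * (g1 * T) + eps * g1 * (g0 * Q)"
      unfolding qT by (simp add: algebra_simps)
    also have "\<dots> = eps * r1 * (g1 * T) + eps * g1 * (g0 * Q)
        + h1 * (q * g0 * g1) * T"
      unfolding q' by (simp add: algebra_simps)
    finally show ?thesis
      unfolding T Q s by (simp add: algebra_simps)
  qed
qed

section \<open>The sequences \<open>a\<close>, \<open>g\<close>, \<open>r\<close> and the matrix of
  a single block\<close>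

locale block_expansion =
  fixes s v m eps :: int
  assumes s_pos: "0 < s" and v_pos: "0 < v" and m_pos: "0 < m"
    and eps: "eps = 1 \<or> eps = -1"
    and disc: "eps = 1 \<or> 4 < v * m\<^sup>2"
begin

abbreviation "a \<equiv> a_seq v m eps"
abbreviation "u \<equiv> v_seq v"
abbreviation "g \<equiv> s_seq s v m eps"
abbreviation "r \<equiv> m_seq s v m eps"
abbreviation "E \<equiv> E_block s v m eps"

text \<open>The value \<open>a\<^sub>-\<^sub>1 = eps\<close> extends the recurrence to \<open>n = 0\<close>.\<close>

definition a_pred :: "nat \<Rightarrow> int" where
  "a_pred n = (if n = 0 then eps else a (n - 1))"

text \<open>The amount subtracted from \<open>xi_hat\<close> before expanding, kept as an integer
  because it enters integral matrices.\<close>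

definition shift :: "nat \<Rightarrow> int" where
  "shift n = (if eps = -1 \<and> 0 < n then 1 else 0)"

lemma eps_sq: "eps * eps = 1"
  using eps by auto

lemma a_Suc: "a (Suc n) = u n * m * a n + eps * a_pred n"
  by (cases n) (simp_all add: a_pred_def eps_sq)

lemma coprime_a_Suc: "coprime (a n) (a (Suc n))"
proof (induction n)
  case 0
  then show ?case by simp
next
  case (Suc n)
  show ?case
  proof (rule coprimeI)
    fix d assume d: "d dvd a (Suc n)" "d dvd a (Suc (Suc n))"
    then have "d dvd eps * a n" by (simp add: dvd_add_right_iff)
    then have "d dvd a n" using eps by auto
    then show "is_unit d" using d(1) Suc.IH by (meson not_coprimeI coprime_common_divisor)
  qed
qed

lemma coprime_a_pred: "coprime (a n) (a_pred n)"
  using eps coprime_a_Suc[of "n - 1"] by (cases n) (auto simp: a_pred_def coprime_commute)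

lemma u_add_2: "u (Suc (Suc n)) = u n" and u_mult_Suc: "u n * u (Suc n) = v"
  and u_pos: "0 < u n"
  using v_pos by (auto simp: v_seq_def)

lemma of_int_v: "real_of_int v = of_int (u n) * of_int (u (Suc n))"
  using u_mult_Suc by (metis of_int_mult)

lemma g_pos: "0 < g n" and g_le: "g n \<le> s" and g_0: "g 0 = s"
  using s_pos by (auto simp: s_seq_def intro: zdvd_imp_le)

lemma r_bounds: "0 \<le> r n" "r n < s div g n"
  and r_cong: "[r n * (a n div g n) = - a_pred n] (mod (s div g n))"
proof -
  have *: "0 \<le> r n \<and> r n < s div g n \<and> [r n * (a n div g n) = - a (n - 1)] (mod (s div g n))"
    unfolding m_seq_def by (rule theI'[OF m_seq_ex1[OF s_pos]])
  then show "0 \<le> r n" "r n < s div g n" by auto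
  show "[r n * (a n div g n) = - a_pred n] (mod (s div g n))"
  \<comment> \<open>At \<open>n = 0\<close> the modulus is 1, so the value chosen for
    \<open>a_pred 0\<close> does not affect the congruence.\<close>
  proof (cases "n = 0")
    case True
    then show ?thesis using s_pos by (simp add: g_0)
  next
    case False
    then show ?thesis using * by (simp add: a_pred_def)
  qed
qed

lemma E_block_expansion:
  "is_cf_expansion (E n) (xi_hat s v m eps n - of_int (shift n))"
  "even (length (E n)) \<longleftrightarrow> eps = -1"
proof -
  define x where "x = xi_hat s v m eps n - of_int (shift n)"
  define P where "P = (if eps = 1 then odd else even :: nat \<Rightarrow> bool)"
  have "x \<in> \<rat>" by (simp add: x_def xi_hat_def)
  moreover have "P = even \<or> P = odd" by (auto simp: P_def)
  ultimately have "is_cf_expansion (cf_expansion P x) x \<and> P (length (cf_expansion P x))"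
    unfolding cf_expansion_def by (rule theI'[OF cf_expansion_ex1])
  moreover have "E n = cf_expansion P x"
    using eps unfolding E_block_def P_def x_def by (auto simp: delta_def shift_def)
  ultimately show "is_cf_expansion (E n) (xi_hat s v m eps n - of_int (shift n))"
    "even (length (E n)) \<longleftrightarrow> eps = -1"
    using eps by (auto simp: x_def P_def)
qed

text \<open>The parity prescribed for \<open>E n\<close> makes \<open>(-1) ^ length (E n)\<close>
  equal to \<open>- eps\<close>. Hence \<open>cf_act_expansion_eqI\<close> applies once the
  candidate is integral, has determinant \<open>- eps\<close> and has \<open>q'\<close> in the right
  range.\<close>

lemma E_block_matrix:
  obtains p p' q q' where "cf_act (E n) (1, 0) = (p, q)" "cf_act (E n) (0, 1) = (p', q')"
    "0 < q" "q * g n * g (Suc n) = s" "p * q' - p' * q = - eps"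
    "p * g (Suc n) = g n * u n * m - eps * r n - shift n * q * g (Suc n)"
    "q' * g n = eps * r (Suc n) + shift (Suc n) * q * g n"
proof -
  obtain q p t where q: "0 < q" "q * g n * g (Suc n) = s"
    and p: "p * g (Suc n) = g n * (u n * m) - eps * r n"
    and t: "t * g n = r (Suc n)" and cong: "[p * t = -1] (mod q)"
  proof (rule block_matrix_congruences[of s "a n" "a (Suc n)" "u n * m" eps "a_pred n"
        "r n" "r (Suc n)"])
    show "[r n * (a n div gcd (a n) s) = - a_pred n] (mod (s div gcd (a n) s))"
      using r_cong[of n] by (simp add: s_seq_def)
    show "[r (Suc n) * (a (Suc n) div gcd (a (Suc n)) s) = - a n] (mod (s div gcd (a (Suc n)) s))"
      using r_cong[of "Suc n"] by (simp add: s_seq_def a_pred_def)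
  qed (use s_pos coprime_a_Suc a_Suc in \<open>auto simp: s_seq_def\<close>)
  have pos: "0 < g n" "0 < g (Suc n)" by (rule g_pos)+
  have sdiv: "s div g n = q * g (Suc n)" "s div g (Suc n) = q * g n"
    using pos q(2) by (auto intro!: div_int_eqI simp: ac_simps)
  define p1 where "p1 = p - shift n * q"
  define q' where "q' = eps * t + shift (Suc n) * q"
  have "0 \<le> t * g n" using r_bounds(1)[of "Suc n"] t by simp
  then have t0: "0 \<le> t" using pos by (simp add: zero_le_mult_iff)
  have "t * g n < q * g n" using r_bounds(2)[of "Suc n"] t sdiv by simp
  then have tq: "t < q" using pos by simp
  have "q dvd p * t + 1" using cong by (simp add: cong_iff_dvd_diff)
  \<comment> \<open>Both summands are divisible by \<open>q\<close>, which provides an integer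
    \<open>p'\<close>.\<close>
  moreover have "p1 * q' + eps = eps * (p * t + 1) + q * (p * shift (Suc n) - shift n * q')"
    unfolding p1_def q'_def by (simp add: algebra_simps)
  ultimately have "q dvd p1 * q' + eps" by simp
  then obtain p' where p': "p1 * q' + eps = q * p'" by (metis dvdE)
  have det: "p1 * q' - p' * q = - eps" using p' by (simp add: algebra_simps)
  have "real_of_int (g n * u n * m - eps * r n) / of_int (s div g n) =
      of_int (p * g (Suc n)) / of_int (q * g (Suc n))"
    by (simp only: p sdiv mult.assoc)
  also have "\<dots> = of_int p / of_int q" using pos by simp
  finally have "xi_hat s v m eps n - of_int (shift n) = of_int p1 / of_int q"
    using q(1) by (simp add: xi_hat_def p1_def field_simps)
  then have cf: "is_cf_expansion (E n) (of_int p1 / of_int q)"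
    using E_block_expansion(1)[of n] by simp
  have "(-1) ^ length (E n) = - eps"
    using E_block_expansion(2)[of n] eps by (cases "even (length (E n))") auto
  then have det': "p1 * q' - p' * q = (-1) ^ length (E n)" using det by simp
  \<comment> \<open>Since \<open>0 \<le> t < q\<close>, the value of \<open>q'\<close> is
    \<open>t\<close> for \<open>eps = 1\<close> and \<open>q - t\<close> for
    \<open>eps = -1\<close>; the shift at \<open>Suc n\<close> is never the exceptional one at
    0.\<close>
  have range: "odd (length (E n)) \<Longrightarrow> 0 \<le> q' \<and> q' < q"
    "even (length (E n)) \<Longrightarrow> 0 < q' \<and> q' \<le> q"
    using E_block_expansion(2)[of n] eps t0 tq unfolding q'_def shift_def by auto
  note act = cf_act_expansion_eqI[OF cf q(1) det' range]
  show ?thesis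
  proof (rule that[OF act q det])
    show "p1 * g (Suc n) = g n * u n * m - eps * r n - shift n * q * g (Suc n)"
      using p by (simp add: p1_def algebra_simps)
    show "q' * g n = eps * r (Suc n) + shift (Suc n) * q * g n"
      using t[symmetric] by (simp add: q'_def algebra_simps)
  qed
qed

section \<open>The concatenation of the first \<open>n\<close> blocks\<close>

definition B :: "nat \<Rightarrow> int list" where
  "B n = concat (map E [0..<n])"

lemma B_Suc: "B (Suc n) = B n @ E n"
  by (simp add: B_def)

text \<open>The block products telescope: \<open>E n\<close> replaces \<open>T_n\<close> by
  \<open>g_n T_{n+1}\<close>. The start is the identity matrix, because \<open>g 0 = s\<close> and
  \<open>r 0 = 0\<close>.\<close>

lemma B_matrix:
  "g n * cf_num (B n) = s * u (Suc n) * a (Suc n)"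
  "g n * cf_den (B n) = a n"
  "cf_num' (B n) = eps * (r n * u (Suc n) * a (Suc n) + g n * u n * a n) + shift n * cf_num (B n)"
  "s * cf_den' (B n) = eps * (r n * a n + g n * a_pred n) + shift n * s * cf_den (B n)"
proof (induction n)
  case 0
  have "r 0 = 0" using r_bounds[of 0] s_pos by (simp add: g_0)
  { case 1 then show ?case by (simp add: B_def g_0 v_seq_def)
  next case 2 then show ?case by (simp add: B_def)
  next case 3 then show ?case using \<open>r 0 = 0\<close> by (simp add: B_def shift_def)
  next case 4 then show ?case using eps_sq by (simp add: B_def shift_def a_pred_def g_0) }
next
  case (Suc n)
  obtain p p' q q' where act: "cf_act (E n) (1, 0) = (p, q)" "cf_act (E n) (0, 1) = (p', q')"
    and q: "0 < q" "q * g n * g (Suc n) = s" and det: "p * q' - p' * q = - eps"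
    and p: "p * g (Suc n) = g n * u n * m - eps * r n - shift n * q * g (Suc n)"
    and q': "q' * g n = eps * r (Suc n) + shift (Suc n) * q * g n"
    by (rule E_block_matrix)
  define P P' Q Q' where defs: "P = cf_num (B n)" "P' = cf_num' (B n)"
    "Q = cf_den (B n)" "Q' = cf_den' (B n)"
  define R R' T T' where defs2: "R = cf_num (B (Suc n))" "R' = cf_num' (B (Suc n))"
    "T = cf_den (B (Suc n))" "T' = cf_den' (B (Suc n))"
  have new: "R = p * P + q * P'" "T = p * Q + q * Q'"
    "R' = p' * P + q' * P'" "T' = p' * Q + q' * Q'"
    using cf_act_linear[of "B n" "(p, q)"] cf_act_linear[of "B n" "(p', q')"]
    unfolding defs defs2 B_Suc cf_act_append act by simp_all
  have IH: "g n * P = s * u (Suc n) * a (Suc n)" "g n * Q = a n"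
    "P' = eps * (r n * u (Suc n) * a (Suc n) + g n * u n * a n) + shift n * P"
    "s * Q' = eps * (r n * a n + g n * a_pred n) + shift n * s * Q"
    using Suc.IH unfolding defs by blast+
  have nz: "g n \<noteq> 0" "g (Suc n) \<noteq> 0" "q \<noteq> 0" "s \<noteq> 0"
    using g_pos[of n] g_pos[of "Suc n"] q(1) s_pos by auto
  note step = block_step[OF nz q(2) det p q' IH new u_add_2 a_Suc[of n] a_seq.simps(3)]
  { case 1 show ?case using step(1) unfolding defs2 .
  next case 2 show ?case using step(2) unfolding defs2 .
  next case 3 show ?case using step(3) unfolding defs2 .
  next case 4 show ?case using step(4) unfolding defs2 by (simp add: a_pred_def) }
qed

lemma cf_value_B: "cf_value (B n) = proj_ratio (s * u (Suc n) * a (Suc n)) (a n)"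
  using proj_ratio_scale[of "g n" "cf_num (B n)" "cf_den (B n)"] g_pos[of n]
  by (simp add: cf_value_eq_proj_ratio B_matrix(1,2))

section \<open>Growth of the sequence \<open>a\<close>\<close>

lemma a_two_step: "a (n + 4) = (v * m\<^sup>2 + 2 * eps) * a (n + 2) - a n"
proof -
  have eqs: "a (n + 4) = u (n + 1) * m * a (n + 3) + eps * a (n + 2)"
    "a (n + 3) = u n * m * a (n + 2) + eps * a (n + 1)"
    "a (n + 2) = u (n + 1) * m * a (n + 1) + eps * a n"
    by (simp_all add: numeral_eq_Suc u_add_2)
  have "a (n + 4) = (u n * u (Suc n)) * m\<^sup>2 * a (n + 2)
      + eps * (u (n + 1) * m * a (n + 1)) + eps * a (n + 2)"
    unfolding eqs(1) eqs(2) by (simp add: algebra_simps power2_eq_square)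
  also have "u (n + 1) * m * a (n + 1) = a (n + 2) - eps * a n"
    using eqs(3) by simp
  finally have "a (n + 4) = v * m\<^sup>2 * a (n + 2) + 2 * eps * a (n + 2) - (eps * eps) * a n"
    unfolding u_mult_Suc by (simp only: algebra_simps)
  then show ?thesis unfolding eps_sq by (simp only: algebra_simps)
qed

text \<open>For \<open>eps = -1\<close> the recurrence subtracts, so growth is derived from
  \<open>a_two_step\<close>. Its coefficient is the trace of two consecutive steps, whose product
  has determinant 1, and a trace of at least 3 keeps \<open>a (n + 2) - a n\<close>
  positive.\<close>

lemma a_add_2: "0 \<le> a n \<and> a n + 1 \<le> a (n + 2)"
proof (induction n rule: less_induct)
  case (less n)
  \<comment> \<open>For \<open>eps = -1\<close> the discriminant condition gives
    \<open>v * m\<^sup>2 \<ge> 5\<close>; for \<open>eps = 1\<close> positivity of \<open>v\<close>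
    and \<open>m\<close> is enough.\<close>
  have L: "3 \<le> v * m\<^sup>2 + 2 * eps"
    using disc eps mult_pos_pos[OF v_pos zero_less_power[OF m_pos, of 2]] by linarith
  consider "n = 0" | "n = 1" | k where "n = k + 2"
    by (metis One_nat_def add_2_eq_Suc' not0_implies_Suc)
  then show ?case
  proof cases
    case 1
    then show ?thesis using m_pos by (simp add: numeral_eq_Suc v_seq_def)
  next
    case 2
    have "a 3 = v * m\<^sup>2 + eps"
      by (simp add: numeral_eq_Suc v_seq_def power2_eq_square)
    moreover have "n + 2 = 3" using 2 by simp
    ultimately have "a (n + 2) = v * m\<^sup>2 + eps" by metis
    then show ?thesis using 2 L eps by (auto simp del: add_2_eq_Suc')
  next
    case 3
    have IH: "0 \<le> a k" "a k + 1 \<le> a (k + 2)" using less[of k] 3 by auto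
    have "3 * a (k + 2) \<le> (v * m\<^sup>2 + 2 * eps) * a (k + 2)"
      using L IH by (intro mult_right_mono) auto
    moreover have "a (n + 2) = (v * m\<^sup>2 + 2 * eps) * a (k + 2) - a k"
      using a_two_step[of k] unfolding 3 add.assoc by simp
    ultimately show ?thesis using IH unfolding 3 by linarith
  qed
qed

lemma a_ge: "int n \<le> 2 * a n"
proof (induction n rule: induct_nat_012)
  case (ge2 n)
  then show ?case using a_add_2[of n] by simp
qed simp_all

lemma a_pos: "0 < n \<Longrightarrow> 0 < a n"
  using a_ge[of n] by linarith

section \<open>Iterates of \<open>f_xi\<close> at infinity\<close>

lemma f_xi_iterate: "(f_xi s v m eps ^^ n) None = proj_ratio (s * u (Suc n) * a (Suc n)) (a n)"
proof (induction n)
  case 0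
  then show ?case by (simp add: proj_ratio_def)
next
  case (Suc n)
  define X where "X = s * u (Suc n) * a (Suc n)"
  have "0 < X" using s_pos u_pos a_pos by (simp add: X_def)
  \<comment> \<open>This includes \<open>a 0 = 0\<close>, where the ratio is infinite and its
    reciprocal is 0.\<close>
  then have "ext_recip (proj_ratio X (a n)) = Some (of_int (a n) / of_int X)"
    by (simp add: proj_ratio_def)
  moreover have "(f_xi s v m eps ^^ Suc n) None = f_xi s v m eps (proj_ratio X (a n))"
    using Suc by (simp add: X_def)
  ultimately have "(f_xi s v m eps ^^ Suc n) None =
      Some (of_int (s * v * m) + of_int (eps * s\<^sup>2 * v) * (of_int (a n) / of_int X))"
    by (simp add: f_xi_def)
  \<comment> \<open>Writing \<open>v = u n * u (Suc n)\<close> turns \<open>f_xi\<close> into the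
    recurrence for \<open>a (Suc (Suc n))\<close>.\<close>
  also have "of_int (s * v * m) + of_int (eps * s\<^sup>2 * v) * (of_int (a n) / of_int X) =
      (of_int (s * u n * (u (Suc n) * m * a (Suc n) + eps * a n)) / of_int (a (Suc n)) :: real)"
  proof -
    have nz: "real_of_int s \<noteq> 0" "real_of_int (u (Suc n)) \<noteq> 0" "real_of_int (a (Suc n)) \<noteq> 0"
      using s_pos u_pos[of "Suc n"] a_pos[of "Suc n"] by auto
    show ?thesis
      using nz by (simp add: X_def of_int_v[of n] field_simps power2_eq_square)
  qed
  also have "Some \<dots> = proj_ratio (s * u (Suc (Suc n)) * a (Suc (Suc n))) (a (Suc n))"
    using a_pos[of "Suc n"] by (simp add: proj_ratio_def u_add_2)
  finally show ?case .
qed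

section \<open>Distance of the iterates from \<open>\<xi>\<close>\<close>

abbreviation "\<xi> \<equiv> xi s v m eps"

text \<open>The number \<open>\<eta>\<close> is the other root of the quadratic polynomial of
  \<open>\<xi>\<close>. Its absolute value is at most \<open>\<xi>\<close> because \<open>d\<close>
  and \<open>sqrt k\<close> are nonnegative.\<close>

lemma xi_conjugate:
  obtains \<eta> where "\<xi> + \<eta> = of_int (s * v * m)" "\<xi> * \<eta> = - of_int (eps * s\<^sup>2 * v)" "\<bar>\<eta>\<bar> \<le> \<xi>"
proof -
  define d where "d = real_of_int (s * v * m) / 2"
  define k where "k = real_of_int (s\<^sup>2 * v * (v * m\<^sup>2 + 4 * eps)) / 4"
  have xi: "\<xi> = d + sqrt k" by (simp add: xi_def d_def k_def)
  have "0 \<le> v * m\<^sup>2 + 4 * eps" using disc eps mult_pos_pos[OF v_pos zero_less_power[OF m_pos, of 2]] by linarith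
  then have "0 \<le> s\<^sup>2 * v * (v * m\<^sup>2 + 4 * eps)" using v_pos by simp
  then have k: "0 \<le> k" unfolding k_def by (metis of_int_0_le_iff zero_le_divide_iff zero_le_numeral)
  have d: "0 \<le> d" using s_pos v_pos m_pos by (simp add: d_def)
  show ?thesis
  proof (rule that[of "d - sqrt k"])
    show "\<xi> + (d - sqrt k) = of_int (s * v * m)" by (simp add: xi d_def)
    have "\<xi> * (d - sqrt k) = d\<^sup>2 - (sqrt k)\<^sup>2" by (simp add: xi algebra_simps power2_eq_square)
    also have "\<dots> = d\<^sup>2 - k" using k by simp
    also have "\<dots> = - of_int (eps * s\<^sup>2 * v)"
      by (simp add: k_def d_def power2_eq_square field_simps)
    finally show "\<xi> * (d - sqrt k) = - of_int (eps * s\<^sup>2 * v)" .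
    show "\<bar>d - sqrt k\<bar> \<le> \<xi>" using d k real_sqrt_ge_zero[OF k] by (simp add: xi abs_le_iff)
  qed
qed

text \<open>For \<open>n > 0\<close> this is \<open>a n\<close> times the difference between the
  \<open>n\<close>-th iterate and \<open>\<xi>\<close>.\<close>

definition err :: "nat \<Rightarrow> real" where
  "err n = of_int (s * u (Suc n) * a (Suc n)) - \<xi> * of_int (a n)"

text \<open>One step multiplies \<open>err n\<close> by \<open>\<eta> / (s * u (Suc n))\<close>,
  hence two steps by \<open>\<eta>\<^sup>2 / (s\<^sup>2 * v)\<close>. This factor is at most 1
  because \<open>\<eta>\<^sup>2 \<le> \<bar>\<xi> * \<eta>\<bar> = s\<^sup>2 * v\<close>.\<close>

lemma err_bounded: obtains C where "\<And>n. \<bar>err n\<bar> \<le> C"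
proof -
  obtain \<eta> where \<eta>: "\<xi> + \<eta> = of_int (s * v * m)" "\<xi> * \<eta> = - of_int (eps * s\<^sup>2 * v)" "\<bar>\<eta>\<bar> \<le> \<xi>"
    by (rule xi_conjugate)
  define S where "S = real_of_int s"
  have S: "0 < S" using s_pos by (simp add: S_def)
  have v: "0 < real_of_int v" using v_pos by simp
  have step: "S * of_int (u (Suc n)) * err (Suc n) = \<eta> * err n" for n
  proof -
    have "err (Suc n) = S * of_int (u n)
        * (of_int (u (Suc n)) * of_int m * of_int (a (Suc n)) + of_int eps * of_int (a n))
        - \<xi> * of_int (a (Suc n))"
      by (simp add: err_def u_add_2 S_def)
    also have "\<dots> = (of_int (s * v * m) - \<xi>) * of_int (a (Suc n))
        + of_int eps * S * of_int (u n) * of_int (a n)"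
      by (simp add: S_def of_int_v[of n] algebra_simps)
    also have "of_int (s * v * m) - \<xi> = \<eta>" using \<eta>(1) by simp
    finally have "S * of_int (u (Suc n)) * err (Suc n) =
        \<eta> * (S * of_int (u (Suc n)) * of_int (a (Suc n))) + of_int (eps * s\<^sup>2 * v) * of_int (a n)"
      by (simp add: S_def algebra_simps power2_eq_square of_int_v[of n])
    also have "\<dots> = \<eta> * (S * of_int (u (Suc n)) * of_int (a (Suc n))) - \<xi> * \<eta> * of_int (a n)"
      unfolding \<eta>(2) by simp
    also have "\<dots> = \<eta> * err n"
      by (simp add: err_def S_def algebra_simps)
    finally show ?thesis .
  qed
  have "\<bar>\<eta>\<bar> * \<bar>\<eta>\<bar> \<le> \<bar>\<xi>\<bar> * \<bar>\<eta>\<bar>" using \<eta>(3) by (intro mult_right_mono) auto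
  also have "\<dots> = \<bar>of_int (eps * s\<^sup>2 * v)\<bar>" using \<eta>(2) by (metis abs_minus_cancel abs_mult)
  also have "\<dots> = S\<^sup>2 * of_int v" using eps v by (auto simp: S_def abs_mult)
  finally have \<eta>_sq: "\<bar>\<eta>\<bar> * \<bar>\<eta>\<bar> \<le> S\<^sup>2 * of_int v" .
  have two: "\<bar>err (Suc (Suc n))\<bar> \<le> \<bar>err n\<bar>" for n
  proof -
    have "S\<^sup>2 * of_int v * err (Suc (Suc n)) =
        S * of_int (u (Suc n)) * (S * of_int (u (Suc (Suc n))) * err (Suc (Suc n)))"
      by (simp add: u_add_2 power2_eq_square of_int_v[of n])
    also have "\<dots> = \<eta> * (S * of_int (u (Suc n)) * err (Suc n))"
      unfolding step[of "Suc n"] by simp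
    also have "\<dots> = \<eta> * \<eta> * err n" unfolding step by simp
    finally have "S\<^sup>2 * of_int v * \<bar>err (Suc (Suc n))\<bar> = \<bar>\<eta>\<bar> * \<bar>\<eta>\<bar> * \<bar>err n\<bar>"
      using S v by (metis abs_mult abs_of_pos zero_less_power mult_pos_pos)
    also have "\<dots> \<le> S\<^sup>2 * of_int v * \<bar>err n\<bar>" using \<eta>_sq by (intro mult_right_mono) auto
    finally show ?thesis using S v by simp
  qed
  have "\<bar>err n\<bar> \<le> \<bar>err 0\<bar> + \<bar>err 1\<bar>" for n
  proof (induction n rule: induct_nat_012)
    case (ge2 n)
    then show ?case using two[of n] by linarith
  qed simp_all
  then show ?thesis by (rule that)
qed

section \<open>Truncations inside a block, and convergence\<close>

lemma E_block_prefix_den: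
  assumes "E n = us @ ws" "us \<noteq> []"
  shows "1 \<le> cf_den us" "cf_den us \<le> s"
proof -
  obtain b bs where us: "us = b # bs" using assms(2) by (cases us) auto
  have pos: "\<forall>c\<in>set (bs @ ws). 0 < c"
    using E_block_expansion(1)[of n] unfolding is_cf_expansion_def assms(1) us by auto
  then show "1 \<le> cf_den us" using cf_den_bounds[of bs b] unfolding us by auto
  obtain p q where "cf_act (E n) (1, 0) = (p, q)" and q: "0 < q" "q * g n * g (Suc n) = s"
    by (rule E_block_matrix)
  then have "cf_den us \<le> q"
    using cf_den_prefix_le[OF pos, of b] assms(1) us by simp
  \<comment> \<open>Denominators increase along the block up to \<open>q\<close>, a divisor of
    \<open>s\<close>; this bound is independent of \<open>n\<close>.\<close>
  also have "q dvd s" using q(2) by (metis dvd_triv_left mult.assoc)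
  then have "q \<le> s" using s_pos by (simp add: zdvd_imp_le)
  finally show "cf_den us \<le> s" .
qed

text \<open>
  Truncating inside a block changes the value by at most \<open>s\<^sup>2 / a\<^sub>n\<close>, because the new denominator
  is a nonzero integer: if it vanished, then \<open>a\<^sub>n\<close> would divide a positive integer at most \<open>s\<^sup>3\<close>.
\<close>

lemma cf_value_B_prefix:
  assumes us: "E n = us @ ws" "us \<noteq> []" and big: "s ^ 3 < a n"
  obtains y where "cf_value (B n @ us) = Some y"
    "\<bar>y - of_int (s * u (Suc n) * a (Suc n)) / of_int (a n)\<bar> \<le> of_int (s\<^sup>2) / of_int (a n)"
proof -
  define x z where "x = cf_num us" and "z = cf_den us"
  define P P' Q Q' where defs: "P = cf_num (B n)" "P' = cf_num' (B n)"
    "Q = cf_den (B n)" "Q' = cf_den' (B n)"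
  define D where "D = x * Q + z * Q'"
  have z: "1 \<le> z" "z \<le> s" using E_block_prefix_den[OF us] by (auto simp: z_def)
  have val: "cf_value (B n @ us) = proj_ratio (x * P + z * P') D"
    using cf_act_linear[of "B n" "cf_act us (1, 0)"]
    unfolding cf_value_eq_proj_ratio cf_act_append D_def x_def z_def defs by simp
  have Q: "g n * Q = a n" and P: "g n * P = s * u (Suc n) * a (Suc n)"
    and Q': "s * Q' = eps * (r n * a n + g n * a_pred n) + shift n * s * Q"
    using B_matrix[of n] unfolding defs by auto
  have a: "0 < a n" using big s_pos by (smt (verit) zero_less_power)
  have g: "0 < g n" "g n \<le> s" by (rule g_pos g_le)+
  have Qpos: "0 < Q" using Q a g by (metis zero_less_mult_pos)
  have "D \<noteq> 0"
  proof
    assume "D = 0"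
    \<comment> \<open>The factor \<open>g n * s\<close> clears the denominators in
      \<open>B_matrix\<close>. Modulo \<open>a n\<close> only the term with \<open>a_pred n\<close>
      survives, and \<open>a_pred n\<close> is coprime to \<open>a n\<close>.\<close>
    then have "0 = eps * (g n * s * D)" by simp
    also have "\<dots> = a n * (eps * s * (x + z * shift n) + g n * z * r n) + (z * g n * g n) * a_pred n"
    proof -
      have "g n * s * D = s * x * (g n * Q) + g n * z * (s * Q')"
        by (simp add: D_def algebra_simps)
      also have "\<dots> = s * x * (g n * Q) + g n * z * eps * (r n * a n + g n * a_pred n)
          + z * shift n * s * (g n * Q)"
        unfolding Q' by (simp add: algebra_simps)
      finally have "eps * (g n * s * D) = eps * s * x * a n
          + (eps * eps) * g n * z * (r n * a n + g n * a_pred n) + eps * z * shift n * s * a n"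
        unfolding Q by (simp add: algebra_simps)
      then show ?thesis unfolding eps_sq by (simp add: algebra_simps)
    qed
    finally have "a n dvd (z * g n * g n) * a_pred n"
      by (metis dvd_add_right_iff dvd_0_right dvd_triv_left)
    then have "a n dvd z * g n * g n"
      using coprime_a_pred by (metis coprime_dvd_mult_left_iff)
    then have "a n \<le> z * g n * g n" using z g by (intro zdvd_imp_le) auto
    also have "\<dots> \<le> s * s * s" using z g s_pos by (intro mult_mono) auto
    finally show False using big by (simp add: power3_eq_cube)
  qed
  define y where "y = real_of_int (x * P + z * P') / of_int D"
  have "P * Q' - P' * Q = (-1) ^ length (B n)" unfolding defs by (rule cf_act_det)
  then have det: "\<bar>real_of_int (P' * Q - P * Q')\<bar> = 1"
    by (metis abs_minus_commute abs_1 abs_neg_one of_int_1 of_int_abs power_abs power_one)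
  \<comment> \<open>In the difference the terms with \<open>x\<close> cancel, and the determinant of
    the matrix of \<open>B n\<close> is left.\<close>
  have "y - of_int P / of_int Q = of_int z * of_int (P' * Q - P * Q') / (of_int Q * of_int D)"
    using Qpos \<open>D \<noteq> 0\<close> by (simp add: y_def field_simps) (simp add: D_def algebra_simps)
  then have "\<bar>y - of_int P / of_int Q\<bar> = of_int z / (of_int Q * \<bar>of_int D\<bar>)"
    using z Qpos det by (simp add: abs_mult del: of_int_diff of_int_mult)
  also have "\<dots> \<le> of_int s / (of_int Q * 1)"
    using z Qpos \<open>D \<noteq> 0\<close> by (intro frac_le mult_left_mono) auto
  also have "\<dots> = of_int (s * g n) / of_int (a n)"
    using g Qpos by (simp flip: Q)
  also have "\<dots> \<le> of_int (s\<^sup>2) / of_int (a n)"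
    using g s_pos a by (intro divide_right_mono) (auto simp: power2_eq_square simp flip: of_int_mult)
  also have "real_of_int P / of_int Q = of_int (s * u (Suc n) * a (Suc n)) / of_int (a n)"
    using g by (simp flip: Q P)
  finally show ?thesis
    using that[of y] val \<open>D \<noteq> 0\<close> by (simp add: proj_ratio_def y_def)
qed

text \<open>The distance to \<open>\<xi>\<close> is at most \<open>s\<^sup>2 / a n\<close> for the
  truncation inside the block plus \<open>C / a n\<close> for the iterate. Finiteness is part of the
  claim, since early truncations may be infinite.\<close>

lemma C_terms_tendsto_xi:
  assumes "0 < e"
  shows "\<forall>\<^sub>F j in sequentially.
    \<exists>y. cf_value (stake (Suc j) (C_terms s v m eps)) = Some y \<and> \<bar>y - \<xi>\<bar> < e"
proof -
  obtain C where C: "\<And>n. \<bar>err n\<bar> \<le> C" using err_bounded by blast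
  then have C0: "0 \<le> C" using abs_ge_zero order_trans by blast
  define K where "K = C + of_int (s\<^sup>2)"
  have K: "0 \<le> K" using C0 by (simp add: K_def)
  \<comment> \<open>Because \<open>n \<le> 2 * a n\<close>, this choice makes \<open>a n\<close>
    exceed both \<open>s ^ 3\<close> and \<open>K / e\<close> for all
    \<open>n \<ge> N\<close>.\<close>
  obtain N :: nat where N: "2 * of_int (s ^ 3) + 2 * K / e < real N" using reals_Archimedean2 by blast
  have len: "length (B k) \<le> length (B l)" if "k \<le> l" for k l
    using that by (rule lift_Suc_mono_le[rotated]) (simp add: B_Suc)
  show ?thesis
  proof (rule eventually_sequentiallyI[of "length (B N)"])
    fix j assume j: "length (B N) \<le> j"
    have ne: "E n \<noteq> []" for n using E_block_expansion(1)[of n] by (simp add: is_cf_expansion_def)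
    obtain n us ws where n: "stake (Suc j) (C_terms s v m eps) = B n @ us"
      "us \<noteq> []" "E n = us @ ws" "j < length (B (Suc n))"
      using stake_flat_blocks[of E j] ne unfolding C_terms_def B_def by metis
    have "N \<le> n" using n(4) j len[of "Suc n" N] by (meson not_less_eq_eq le_trans not_less)
    moreover have "real n \<le> 2 * of_int (a n)" using a_ge[of n] by linarith
    ultimately have an: "of_int (s ^ 3) + K / e < real_of_int (a n)" using N by linarith
    have "0 \<le> K / e" using K assms by simp
    then have big: "s ^ 3 < a n" using an by linarith
    then have a: "0 < a n" using s_pos by (smt (verit) zero_less_power)
    define A where "A = real_of_int (a n)"
    have A: "0 < A" using a by (simp add: A_def)
    obtain y where y: "cf_value (B n @ us) = Some y"
      "\<bar>y - of_int (s * u (Suc n) * a (Suc n)) / A\<bar> \<le> of_int (s\<^sup>2) / A"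
      using cf_value_B_prefix[OF n(3,2) big] unfolding A_def by blast
    define w where "w = of_int (s * u (Suc n) * a (Suc n)) / A"
    have "w - \<xi> = err n / A"
      using A unfolding err_def A_def[symmetric] w_def by (simp add: field_simps)
    then have "\<bar>w - \<xi>\<bar> \<le> C / A"
      using A C[of n] by (simp add: divide_right_mono)
    then have "\<bar>y - \<xi>\<bar> \<le> K / A"
      using y(2) unfolding K_def add_divide_distrib w_def[symmetric] by linarith
    also have "K / A < e"
    proof -
      have "0 < real_of_int (s ^ 3)" using s_pos by simp
      then have "K / e < A" using an unfolding A_def by linarith
      then show ?thesis using A assms by (simp add: field_simps)
    qed
    finally show "\<exists>y. cf_value (stake (Suc j) (C_terms s v m eps)) = Some y \<and> \<bar>y - \<xi>\<bar> < e"
      using y(1) n(1) by auto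
  qed
qed

end

text \<open>Open sets of the compactification have open preimages under \<open>Some\<close>, so a
  neighbourhood of a finite point contains the image of a real interval around it.\<close>

lemma limitin_Alexandroff_SomeI:
  fixes l :: real
  assumes "\<And>e. 0 < e \<Longrightarrow> \<forall>\<^sub>F j in F. \<exists>y. f j = Some y \<and> \<bar>y - l\<bar> < e"
  shows "limitin (Alexandroff_compactification euclideanreal) f (Some l) F"
  unfolding limitin_def
proof (intro conjI allI impI)
  show "Some l \<in> topspace (Alexandroff_compactification euclideanreal)" by simp
  fix U assume U: "openin (Alexandroff_compactification euclideanreal) U \<and> Some l \<in> U"
  then have "open {x. Some x \<in> U}"
    using openin_continuous_map_preimage[OF continuous_map_Some[of euclideanreal], of U] by simp
  moreover have "l \<in> {x. Some x \<in> U}" using U by simp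
  ultimately obtain e where e: "0 < e" "\<And>y. \<bar>y - l\<bar> < e \<Longrightarrow> Some y \<in> U"
    unfolding open_dist dist_real_def by blast
  show "\<forall>\<^sub>F j in F. f j \<in> U"
    using assms[OF e(1)] by (rule eventually_mono) (use e(2) in auto)
qed

theorem theorem3p3:
  fixes s v m eps :: int
  assumes "0 < s" and "0 < v" and "0 < m"
    and "eps \<in> {1, -1}"
    and "\<not> (eps = -1 \<and> v * m\<^sup>2 \<le> 4)"
  shows "limitin (Alexandroff_compactification euclideanreal)
           (\<lambda>j. cf_value (stake (Suc j) (C_terms s v m eps)))
           (Some (xi s v m eps)) sequentially
       \<and> (\<forall>n. cf_value (concat (map (E_block s v m eps) [0..<n])) = (f_xi s v m eps ^^ n) None)"
proof -
  interpret block_expansion s v m eps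
    using assms by unfold_locales auto
  show ?thesis
  proof (intro conjI allI)
    show "limitin (Alexandroff_compactification euclideanreal)
        (\<lambda>j. cf_value (stake (Suc j) (C_terms s v m eps))) (Some (xi s v m eps)) sequentially"
      by (rule limitin_Alexandroff_SomeI) (rule C_terms_tendsto_xi)
    show "cf_value (concat (map (E_block s v m eps) [0..<n])) = (f_xi s v m eps ^^ n) None" for n
      using cf_value_B[of n] f_xi_iterate[of n] unfolding B_def by metis
  qed
qed

end
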